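(* Let $X$ be a nonempty regular space of the first category such that the set $wPS(X)$ is dense in $X$. Then $X$ contains a closed copy of the space of rational numbers, i.e., there is a closed subset of $X$ which, with the subspace topology, is homeomorphic to $\mathbb{Q}$.
   Context: Terminology follows Engelking's "General Topology"; in particular, regular spaces are assumed to be $T_1$. The space of rational numbers $\mathbb{Q}$ carries its usual topology inherited from $\mathbb{R}$. A space $X$ is of the first category if it is the union of countably many nowhere dense subsets of $X$. A sequence $\langle U_n \colon n \in \omega \rangle$ of subsets of a space converges to a point $x$ if each neighborhood of $x$ contains all but finitely many of the sets $U_n$. A space $X$ is weakly Preiss-Simon at a point $x \in X$ if there is a sequence $\langle U_n \colon n \in \omega \rangle$ of nonempty open subsets of $X$ that converges to $x$. $wPS(X)$ denotes the set of points $x \in X$ at which $X$ is weakly Preiss-Simon. *)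

theory Defs
  imports "HOL-Analysis.Analysis"
begin

definition nowhere_dense_in :: "'a topology \<Rightarrow> 'a set \<Rightarrow> bool" where
  "nowhere_dense_in X A \<longleftrightarrow> A \<subseteq> topspace X \<and> X interior_of (X closure_of A) = {}"

definition first_category_space :: "'a topology \<Rightarrow> bool" where
  "first_category_space X \<longleftrightarrow>
     (\<exists>\<A>. countable \<A> \<and> (\<forall>A\<in>\<A>. nowhere_dense_in X A) \<and> \<Union>\<A> = topspace X)"

text \<open>Convergence quantifies over open neighbourhoods; since every neighbourhood of a point
  contains an open one, this is the same as quantifying over all neighbourhoods.
  The sequence may repeat sets: ``all but finitely many'' refers to indices.\<close>

definition sets_converge_to :: "'a topology \<Rightarrow> (nat \<Rightarrow> 'a set) \<Rightarrow> 'a \<Rightarrow> bool" where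
  "sets_converge_to X U x \<longleftrightarrow>
     (\<forall>V. openin X V \<and> x \<in> V \<longrightarrow> finite {n. \<not> U n \<subseteq> V})"

definition weakly_Preiss_Simon_at :: "'a topology \<Rightarrow> 'a \<Rightarrow> bool" where
  "weakly_Preiss_Simon_at X x \<longleftrightarrow>
     (\<exists>U :: nat \<Rightarrow> 'a set. (\<forall>n. openin X (U n) \<and> U n \<noteq> {}) \<and> sets_converge_to X U x)"

definition wPS :: "'a topology \<Rightarrow> 'a set" where
  "wPS X = {x \<in> topspace X. weakly_Preiss_Simon_at X x}"

end

theory Submission
  imports Defs
begin

text \<open>
  The rationals are described by a combinatorial pattern, and that pattern is then found as a closed
  set in \<open>X\<close>.

  The pattern is a tree of points \<open>x s\<close>, indexed by finite sequences \<open>s\<close> of natural numbers. Each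
  \<open>x s\<close> has an open neighbourhood \<open>U s\<close>, and inside it the sets of the children of \<open>s\<close> are pairwise
  disjoint, have closures that miss \<open>x s\<close>, and converge to \<open>x s\<close>. These conditions
  (\<open>pointed_scheme\<close>) determine the subspace topology on the set of all \<open>x s\<close> completely: a set of
  points is open iff, with each \<open>x s\<close>, it contains the whole branches above all but finitely many
  children of \<open>s\<close>. So the ranges of any two schemes are homeomorphic, in whatever spaces they
  live (\<open>scheme_range_homeomorphic_tree\<close>).

  One such scheme exhausts the rationals. Fix an enumeration, let \<open>x s\<close> be the first element of a
  clopen set \<open>U s\<close>, and split the rest of \<open>U s\<close> into clopen shells that shrink to \<open>x s\<close>. A rational
  that is never chosen would have infinitely many predecessors in the enumeration
  (\<open>Rats_homeomorphic_tree\<close>).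

  In \<open>X\<close>, density of \<open>wPS X\<close> allows all \<open>x s\<close> to be taken in \<open>wPS X\<close>, so that there are open sets
  converging to \<open>x s\<close>; as \<open>X\<close> has no isolated points, they can be shrunk and thinned out to
  serve as the children (\<open>weakly_Preiss_Simon_pointed_refinement\<close>). The first category makes the
  range closed: cover \<open>X\<close> by closed sets \<open>F k\<close> with empty interior and keep the sets of level
  \<open>k + 1\<close> away from \<open>F k\<close>. A limit of the points \<open>x s\<close> that is none of them would follow an infinite
  branch and hence lie in no \<open>F k\<close> at all (\<open>closedin_scheme_range\<close>).
\<close>

section \<open>The canonical topology on the tree of finite sequences\<close>

text \<open>The children of \<open>s\<close> are the sequences \<open>n # s\<close>, so that constructions along the tree are
  recursions on lists. The sequences above \<open>s\<close> are then those of the form \<open>u @ s\<close>, and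
  \<open>tree_open\<close> says that whole branches converge to the node from which they spring.\<close>

definition tree_open :: "nat list set \<Rightarrow> bool" where
  "tree_open A \<longleftrightarrow> (\<forall>s\<in>A. finite {n. \<not> (\<forall>u. u @ n # s \<in> A)})"

definition tree_topology :: "nat list topology" where
  "tree_topology = topology tree_open"

lemma istopology_tree_open: "istopology tree_open"
  unfolding istopology_def
proof (intro conjI allI impI)
  fix A B assume "tree_open A" "tree_open B"
  show "tree_open (A \<inter> B)"
    unfolding tree_open_def
  proof
    fix s assume "s \<in> A \<inter> B"
    then have "finite ({n. \<not> (\<forall>u. u @ n # s \<in> A)} \<union> {n. \<not> (\<forall>u. u @ n # s \<in> B)})"
      using \<open>tree_open A\<close> \<open>tree_open B\<close> by (simp add: tree_open_def)
    then show "finite {n. \<not> (\<forall>u. u @ n # s \<in> A \<inter> B)}"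
      by (rule rev_finite_subset) auto
  qed
next
  fix K assume K: "\<forall>A\<in>K. tree_open A"
  show "tree_open (\<Union>K)"
    unfolding tree_open_def
  proof
    fix s assume "s \<in> \<Union>K"
    then obtain A where A: "A \<in> K" "s \<in> A" by blast
    then have "finite {n. \<not> (\<forall>u. u @ n # s \<in> A)}"
      using K by (simp add: tree_open_def)
    then show "finite {n. \<not> (\<forall>u. u @ n # s \<in> \<Union>K)}"
      by (rule rev_finite_subset) (use A in auto)
  qed
qed

lemma openin_tree_topology [simp]: "openin tree_topology = tree_open"
  by (simp add: tree_topology_def istopology_tree_open topology_inverse')

lemma topspace_tree_topology [simp]: "topspace tree_topology = UNIV"
  using openin_subset[of tree_topology UNIV] by (auto simp: tree_open_def)

section \<open>Pointed schemes\<close>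

definition pointed_refinement ::
    "'a topology \<Rightarrow> 'a \<Rightarrow> 'a set \<Rightarrow> (nat \<Rightarrow> 'a set) \<Rightarrow> bool" where
  "pointed_refinement X y U V \<longleftrightarrow>
     (\<forall>n. X closure_of V n \<subseteq> U - {y}) \<and> disjoint_family V \<and> sets_converge_to X V y"

text \<open>Convergence of the children takes the place of a countable neighbourhood base: it makes \<open>x s\<close>
  together with the branches above almost all of its children a basic neighbourhood of \<open>x s\<close> within
  the set of all points of the scheme.\<close>

definition pointed_scheme :: "'a topology \<Rightarrow> (nat list \<Rightarrow> 'a) \<Rightarrow> (nat list \<Rightarrow> 'a set) \<Rightarrow> bool" where
  "pointed_scheme X x U \<longleftrightarrow>
     (\<forall>s. openin X (U s) \<and> x s \<in> U s \<and> pointed_refinement X (x s) (U s) (\<lambda>n. U (n # s)))"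

context
  fixes X :: "'a topology" and x U
  assumes scheme: "pointed_scheme X x U"
begin

lemma scheme_open: "openin X (U s)"
  and scheme_point: "x s \<in> U s"
  and scheme_closure_subset: "X closure_of U (n # s) \<subseteq> U s - {x s}"
  and scheme_siblings_disjoint: "disjoint_family (\<lambda>n. U (n # s))"
  and scheme_converges: "sets_converge_to X (\<lambda>n. U (n # s)) (x s)"
  using scheme unfolding pointed_scheme_def pointed_refinement_def by blast+

lemma scheme_child_subset: "U (n # s) \<subseteq> U s - {x s}"
  using scheme_closure_subset[of n s] closure_of_subset[OF openin_subset[OF scheme_open]]
  by fast

lemma scheme_append_subset: "U (u @ s) \<subseteq> U s"
  by (induction u) (use scheme_child_subset in auto)

lemma scheme_range_subset: "range x \<subseteq> topspace X"
  using scheme_open scheme_point openin_subset by blast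

text \<open>The points of the scheme in \<open>U s\<close> are exactly those of the branch above \<open>s\<close>: the points of
  other branches are excluded by disjointness of siblings, those below \<open>s\<close> because a child's set
  misses the point of its parent.\<close>

lemma scheme_point_in_iff: "x t \<in> U s \<longleftrightarrow> (\<exists>u. t = u @ s)"
proof
  show "\<exists>u. t = u @ s" if "x t \<in> U s"
    using that
  proof (induction s)
    case Nil
    then show ?case by simp
  next
    case (Cons n s)
    then have "x t \<in> U s" "x t \<noteq> x s"
      using scheme_child_subset by auto
    obtain u where u: "t = u @ s"
      using Cons.IH[OF \<open>x t \<in> U s\<close>] by blast
    have "u \<noteq> []" using u \<open>x t \<noteq> x s\<close> by auto
    then obtain v m where v: "t = v @ m # s"
      using u by (cases u rule: rev_cases) auto
    then have "x t \<in> U (m # s)"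
      using scheme_point[of t] scheme_append_subset[of v "m # s"] by blast
    then have "m = n"
      using Cons.prems scheme_siblings_disjoint[of s] by (auto simp: disjoint_family_on_def)
    then show ?case using v by auto
  qed
next
  show "x t \<in> U s" if "\<exists>u. t = u @ s"
    using that scheme_point[of t] scheme_append_subset by blast
qed

lemma scheme_inj: "inj x"
proof (rule injI)
  fix s t assume "x s = x t"
  then have "x t \<in> U s" "x s \<in> U t" using scheme_point by metis+
  then show "s = t" by (auto simp: scheme_point_in_iff)
qed

text \<open>This is why the topology depends on the tree alone. If \<open>W\<close> is open and contains \<open>x s\<close>, convergence
  puts almost all sets \<open>U (n # s)\<close> into \<open>W\<close>. Conversely, removing from \<open>U s\<close> the closures of finitely
  many children leaves a neighbourhood of \<open>x s\<close> whose scheme points belong to \<open>s\<close> and to the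
  remaining branches.\<close>

lemma openin_scheme_range_iff:
  "openin (subtopology X (range x)) (x ` A) \<longleftrightarrow> tree_open A"
proof
  assume "openin (subtopology X (range x)) (x ` A)"
  then obtain W where W: "openin X W" "x ` A = W \<inter> range x"
    by (auto simp: openin_subtopology)
  have A: "s \<in> A \<longleftrightarrow> x s \<in> W" for s
    using W(2) scheme_inj by (metis Int_iff inj_image_mem_iff rangeI)
  show "tree_open A"
    unfolding tree_open_def
  proof
    fix s assume "s \<in> A"
    then have "finite {n. \<not> U (n # s) \<subseteq> W}"
      using scheme_converges[of s] W(1) A by (simp add: sets_converge_to_def)
    moreover have "u @ n # s \<in> A" if "U (n # s) \<subseteq> W" for n u
      using that A scheme_point[of "u @ n # s"] scheme_append_subset[of u "n # s"] by blast
    then have "{n. \<not> (\<forall>u. u @ n # s \<in> A)} \<subseteq> {n. \<not> U (n # s) \<subseteq> W}"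
      by blast
    ultimately show "finite {n. \<not> (\<forall>u. u @ n # s \<in> A)}"
      by (rule rev_finite_subset)
  qed
next
  assume open_A: "tree_open A"
  define B where "B s = {n. \<not> (\<forall>u. u @ n # s \<in> A)}" for s
  define W where "W s = U s - (\<Union>n\<in>B s. X closure_of U (n # s))" for s
  have "openin X (W s)" if "s \<in> A" for s
  proof -
    have "finite (B s)" using open_A that by (simp add: tree_open_def B_def)
    then show ?thesis
      unfolding W_def by (intro openin_diff scheme_open closedin_Union) auto
  qed
  then have "openin X (\<Union>s\<in>A. W s)" by blast
  moreover have "x ` A = (\<Union>s\<in>A. W s) \<inter> range x"
  proof
    have "x s \<in> W s" for s
      using scheme_point scheme_closure_subset unfolding W_def by blast
    then show "x ` A \<subseteq> (\<Union>s\<in>A. W s) \<inter> range x" by blast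
  next
    show "(\<Union>s\<in>A. W s) \<inter> range x \<subseteq> x ` A"
    proof clarify
      fix s t assume s: "s \<in> A" "x t \<in> W s"
      then obtain u where u: "t = u @ s"
        unfolding W_def using scheme_point_in_iff by blast
      show "x t \<in> x ` A"
      proof (cases u rule: rev_cases)
        case Nil
        then show ?thesis using u s by simp
      next
        case (snoc v n)
        then have "x t \<in> X closure_of U (n # s)"
          using u scheme_point_in_iff[of t "n # s"]
            closure_of_subset[OF openin_subset[OF scheme_open[of "n # s"]]] by auto
        then have "n \<notin> B s" using s unfolding W_def by blast
        then show ?thesis using u snoc by (simp add: B_def)
      qed
    qed
  qed
  ultimately show "openin (subtopology X (range x)) (x ` A)"
    by (auto simp: openin_subtopology)
qed

proposition scheme_range_homeomorphic_tree:
  "tree_topology homeomorphic_space subtopology X (range x)"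
proof -
  have top: "topspace (subtopology X (range x)) = range x"
    using scheme_range_subset by auto
  have "homeomorphic_map tree_topology (subtopology X (range x)) x"
  proof (rule bijective_open_imp_homeomorphic_map)
    show "continuous_map tree_topology (subtopology X (range x)) x"
      unfolding continuous_map_def
    proof (intro conjI allI impI)
      fix W assume W: "openin (subtopology X (range x)) W"
      then have "x ` {s. x s \<in> W} = W"
        using openin_subset top by fastforce
      then show "openin tree_topology {s \<in> topspace tree_topology. x s \<in> W}"
        using W openin_scheme_range_iff[of "{s. x s \<in> W}"] by simp
    qed (use top in auto)
    show "open_map tree_topology (subtopology X (range x)) x"
      by (simp add: open_map_def openin_scheme_range_iff)
  qed (use top scheme_inj in auto)
  then show ?thesis
    using homeomorphic_map_imp_homeomorphic_space by blast
qed

end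

text \<open>The recursion that produces schemes: all children of a node are chosen simultaneously, subject
  to a condition \<open>R\<close> that may depend on the level.\<close>

lemma dependent_choice_on_nat_tree:
  assumes "G a"
    and step: "\<And>k a. G a \<Longrightarrow> \<exists>b :: nat \<Rightarrow> 'b. (\<forall>n. G (b n)) \<and> R k a b"
  shows "\<exists>f. f [] = a \<and> (\<forall>s. G (f s)) \<and> (\<forall>s. R (length s) (f s) (\<lambda>n. f (n # s)))"
proof -
  have "\<forall>k a. \<exists>b. G a \<longrightarrow> (\<forall>n. G (b n)) \<and> R k a b"
    using step by blast
  then obtain \<beta> where \<beta>: "\<And>k a n. G a \<Longrightarrow> G (\<beta> k a n)" "\<And>k a. G a \<Longrightarrow> R k a (\<beta> k a)"
    by metis
  define f where "f = rec_list a (\<lambda>n s c. \<beta> (length s) c n)"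
  have f: "f [] = a" "\<And>n s. f (n # s) = \<beta> (length s) (f s) n"
    by (simp_all add: f_def)
  have "G (f s)" for s
    by (induction s) (auto simp: f \<beta> \<open>G a\<close>)
  then show ?thesis
    using f \<beta>(2) by (intro exI[of _ f]) simp
qed

section \<open>The rationals carry an exhausting scheme\<close>

text \<open>No rational lies at an irrational distance from a rational, so the open and the closed ball have
  the same rational points.\<close>

lemma clopen_ball_in_Rats:
  fixes r a :: real
  assumes "r \<notin> \<rat>" "a \<in> \<rat>"
  shows "openin (top_of_set \<rat>) (\<rat> \<inter> ball a r)" "closedin (top_of_set \<rat>) (\<rat> \<inter> ball a r)"
proof -
  show "openin (top_of_set \<rat>) (\<rat> \<inter> ball a r)"
    by (simp add: openin_open_Int)
  have "dist a y \<noteq> r" if "y \<in> \<rat>" for y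
  proof
    assume "dist a y = r"
    moreover have "a - y \<in> \<rat>" "y - a \<in> \<rat>" using that assms by simp_all
    ultimately have "r \<in> \<rat>" by (auto simp: dist_real_def abs_if split: if_splits)
    then show False using assms(1) by simp
  qed
  then have "\<rat> \<inter> ball a r = \<rat> \<inter> cball a r"
    by (auto simp: less_le)
  then show "closedin (top_of_set \<rat>) (\<rat> \<inter> ball a r)"
    by (simp add: closedin_closed_Int)
qed

lemma irrational_null_sequence:
  obtains r :: "nat \<Rightarrow> real" where "\<And>n. r n \<notin> \<rat>" "\<And>n. 0 < r n" "decseq r" "r \<longlonglongrightarrow> 0"
proof -
  have "uncountable {0<..<1::real}"
    by (simp add: uncountable_open_interval)
  then obtain \<xi> :: real where \<xi>: "\<xi> \<notin> \<rat>" "0 < \<xi>"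
    by (metis countable_rat countable_subset greaterThanLessThan_iff subsetI)
  show thesis
  proof
    show "\<xi> / real (Suc n) \<notin> \<rat>" for n
    proof
      assume "\<xi> / real (Suc n) \<in> \<rat>"
      then have "\<xi> / real (Suc n) * real (Suc n) \<in> \<rat>"
        by (intro Rats_mult Rats_of_nat)
      then show False using \<xi> by (simp del: of_nat_Suc)
    qed
    show "0 < \<xi> / real (Suc n)" for n using \<xi> by simp
    show "decseq (\<lambda>n. \<xi> / real (Suc n))"
      using \<xi> by (auto simp: decseq_def intro!: divide_left_mono)
    show "(\<lambda>n. \<xi> / real (Suc n)) \<longlonglongrightarrow> 0"
      by (rule LIMSEQ_Suc[OF lim_const_over_n])
  qed
qed

text \<open>The sets are differences of consecutive balls of irrational radii around \<open>a\<close>, cut down to \<open>U\<close>.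
  Some differences may be empty, but infinitely many are not because \<open>a\<close> is not isolated; these
  are enumerated.\<close>

lemma Rats_clopen_pointed_refinement:
  fixes U :: "real set" and a :: real
  defines "Q \<equiv> top_of_set (\<rat> :: real set)"
  assumes U: "openin Q U" "closedin Q U" and a: "a \<in> U"
  shows "\<exists>V. (\<forall>n. openin Q (V n) \<and> closedin Q (V n) \<and> V n \<noteq> {}) \<and>
             pointed_refinement Q a U V \<and> (\<Union>n. V n) = U - {a}"
proof -
  have U_sub: "U \<subseteq> \<rat>" using U(1) openin_subset Q_def by fastforce
  then have aQ: "a \<in> \<rat>" using a by blast
  obtain r :: "nat \<Rightarrow> real" where r: "\<And>n. r n \<notin> \<rat>" "\<And>n. 0 < r n" "decseq r" "r \<longlonglongrightarrow> 0"
    using irrational_null_sequence by metis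
  \<comment> \<open>The sequence starts with \<open>U\<close> itself, so that the shells exhaust \<open>U - {a}\<close>.\<close>
  define B where "B n = (case n of 0 \<Rightarrow> U | Suc m \<Rightarrow> U \<inter> (\<rat> \<inter> ball a (r m)))" for n
  have B_0: "B 0 = U" and B_Suc: "B (Suc m) = U \<inter> (\<rat> \<inter> ball a (r m))" for m
    by (simp_all add: B_def)
  have B_Suc_clopen: "openin Q (B (Suc m))" "closedin Q (B (Suc m))" for m
    using U clopen_ball_in_Rats[OF r(1) aQ] unfolding Q_def B_Suc
    by (blast intro: openin_Int closedin_Int)+
  have B_clopen: "openin Q (B n)" "closedin Q (B n)" for n
    using U B_Suc_clopen by (cases n; simp add: B_0)+
  have aB: "a \<in> B n" for n
    using a aQ r(2) by (cases n) (simp_all add: B_0 B_Suc)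
  have "B (Suc n) \<subseteq> B n" for n
  proof (cases n)
    case (Suc m)
    have "ball a (r (Suc m)) \<subseteq> ball a (r m)"
      using decseqD[OF r(3), of m "Suc m"] by (simp add: subset_ball)
    then show ?thesis by (auto simp only: Suc B_Suc)
  qed (simp add: B_0 B_Suc)
  then have B_anti: "B n \<subseteq> B m" if "m \<le> n" for m n
    using that by (rule lift_Suc_antimono_le)
  have escape: "\<exists>n>m. y \<notin> B n" if "y \<noteq> a" for y m
  proof -
    have "\<forall>\<^sub>F n in sequentially. r n < dist a y"
      using r(4) that by (intro order_tendstoD) auto
    then obtain N where "r (max N m) < dist a y"
      unfolding eventually_sequentially by (meson max.cobounded1)
    then have "y \<notin> B (Suc (max N m))" by (simp add: B_Suc)
    then show ?thesis by (intro exI[of _ "Suc (max N m)"]) auto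
  qed
  define D where "D n = B n - B (Suc n)" for n
  have D_clopen: "openin Q (D n)" "closedin Q (D n)" for n
    using B_clopen by (simp_all add: D_def openin_diff closedin_diff)
  have leave: "\<exists>n\<ge>m. y \<in> D n" if "y \<in> B m" "y \<noteq> a" for y m
  proof -
    define k where "k = (LEAST k. y \<notin> B k)"
    have k: "y \<notin> B k" "\<And>j. y \<notin> B j \<Longrightarrow> k \<le> j"
      unfolding k_def using escape[OF that(2)] by (metis LeastI, metis Least_le)
    have "m < k" using that(1) k(1) B_anti by (meson not_le subsetD)
    then obtain n where n: "k = Suc n" "m \<le> n" by (metis Suc_le_D Suc_le_eq Suc_le_mono)
    then have "y \<in> B n" using k(2)[of n] by auto
    then show ?thesis using n k(1) by (auto simp: D_def)
  qed
  define I where "I = {n. D n \<noteq> {}}"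
  have "\<exists>n\<ge>m. n \<in> I" for m
  proof -
    obtain T where T: "open T" "B m = \<rat> \<inter> T"
      using B_clopen(1) unfolding Q_def openin_open by blast
    then obtain e where e: "e > 0" "ball a e \<subseteq> T"
      using aB[of m] open_contains_ball by blast
    obtain y where y: "y \<in> \<rat>" "a < y" "y < a + e"
      using Rats_dense_in_real[of a "a + e"] e by auto
    then have "y \<in> B m" using T(2) e(2) by (auto simp: dist_real_def subset_iff)
    then show ?thesis using leave[of y m] y by (auto simp: I_def)
  qed
  then have I_inf: "infinite I"
    by (auto simp: infinite_nat_iff_unbounded_le)
  define V where "V k = D (enumerate I k)" for k
  have V_ne: "V k \<noteq> {}" for k
    using enumerate_in_set[OF I_inf, of k] by (simp add: V_def I_def)
  have V_sub: "V k \<subseteq> U - {a}" for k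
    using aB[of "Suc (enumerate I k)"] B_anti[of 0 "enumerate I k"]
    unfolding V_def D_def B_0 by blast
  have "disjoint_family D"
  proof -
    have "D m \<inter> D n = {}" if "m < n" for m n
      using B_anti[of "Suc m" n] that by (auto simp: D_def)
    then show ?thesis
      unfolding disjoint_family_on_def by (metis Int_commute nat_neq_iff)
  qed
  then have disj: "disjoint_family V"
    using strict_mono_eq[OF strict_mono_enumerate[OF I_inf]]
    unfolding V_def disjoint_family_on_def by simp
  have conv: "sets_converge_to Q V a"
    unfolding sets_converge_to_def
  proof (intro allI impI)
    fix W assume W: "openin Q W \<and> a \<in> W"
    then obtain T where T: "open T" "W = \<rat> \<inter> T"
      unfolding Q_def openin_open by blast
    then obtain e where e: "e > 0" "ball a e \<subseteq> T"
      using W open_contains_ball by blast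
    have "\<forall>\<^sub>F n in sequentially. r n < e"
      using r(4) e by (intro order_tendstoD) auto
    then obtain N where N: "r N < e"
      unfolding eventually_sequentially by blast
    have "V k \<subseteq> W" if "Suc N \<le> k" for k
    proof -
      have "Suc N \<le> enumerate I k"
        using le_enumerate[OF I_inf, of k] that by linarith
      then have "V k \<subseteq> B (Suc N)" using B_anti unfolding V_def D_def by blast
      also have "\<dots> \<subseteq> \<rat> \<inter> ball a e" using N by (auto simp: B_Suc)
      finally show ?thesis using T e by blast
    qed
    then have "{n. \<not> V n \<subseteq> W} \<subseteq> {..N}"
      by (metis (mono_tags, lifting) atMost_iff mem_Collect_eq not_less_eq_eq subsetI)
    then show "finite {n. \<not> V n \<subseteq> W}" using finite_subset by blast
  qed
  have cover: "(\<Union>n. V n) = U - {a}"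
  proof
    show "(\<Union>n. V n) \<subseteq> U - {a}" using V_sub by blast
    show "U - {a} \<subseteq> (\<Union>n. V n)"
    proof
      fix y assume "y \<in> U - {a}"
      then obtain n where n: "y \<in> D n" using leave[of y 0] by (auto simp: B_0)
      then have "n \<in> I" by (auto simp: I_def)
      then obtain k where "enumerate I k = n" using enumerate_Ex[OF I_inf] by blast
      then show "y \<in> (\<Union>n. V n)" using n unfolding V_def by blast
    qed
  qed
  have V_clopen: "openin Q (V n)" "closedin Q (V n)" for n
    using D_clopen by (simp_all add: V_def)
  then have "pointed_refinement Q a U V"
    using V_sub disj conv by (simp add: pointed_refinement_def closure_of_closedin)
  then show ?thesis
    using V_ne V_clopen cover by blast
qed

proposition Rats_homeomorphic_tree: "tree_topology homeomorphic_space top_of_set (\<rat> :: real set)"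
proof -
  define Q where "Q = top_of_set (\<rat> :: real set)"
  \<comment> \<open>The point of a set is its first element in a fixed enumeration of the rationals.\<close>
  define p where "p U = (ARG_MIN (to_nat_on \<rat>) y. y \<in> U)" for U :: "real set"
  have p: "p U \<in> U" "\<And>y. y \<in> U \<Longrightarrow> to_nat_on \<rat> (p U) \<le> to_nat_on \<rat> y" if "U \<noteq> {}" for U
    using that arg_min_nat_lemma[of "\<lambda>y. y \<in> U" _ "to_nat_on \<rat>"] unfolding p_def by blast+
  define G where "G U \<longleftrightarrow> openin Q U \<and> closedin Q U \<and> U \<noteq> {}" for U
  have "\<exists>U. U [] = \<rat> \<and> (\<forall>s. G (U s)) \<and>
      (\<forall>s. pointed_refinement Q (p (U s)) (U s) (\<lambda>n. U (n # s)) \<and>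
           (\<Union>n. U (n # s)) = U s - {p (U s)})"
  proof (rule dependent_choice_on_nat_tree[where
        R = "\<lambda>k U V. pointed_refinement Q (p U) U V \<and> (\<Union>n. V n) = U - {p U}"])
    show "G \<rat>"
      using Rats_0 unfolding G_def Q_def by (metis closedin_subtopology_refl empty_iff
          openin_subtopology_self subset_UNIV topspace_euclidean)
    fix U assume "G U"
    then show "\<exists>V. (\<forall>n. G (V n)) \<and> pointed_refinement Q (p U) U V \<and> (\<Union>n. V n) = U - {p U}"
      using Rats_clopen_pointed_refinement[of U "p U"] p(1)[of U]
      unfolding G_def Q_def by fast
  qed
  then obtain U where U_Nil: "U [] = \<rat>" and U_G: "\<forall>s. G (U s)" and
    U_step: "\<forall>s. pointed_refinement Q (p (U s)) (U s) (\<lambda>n. U (n # s)) \<and>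
           (\<Union>n. U (n # s)) = U s - {p (U s)}"
    by (elim exE conjE) (rule that)
  define x where "x s = p (U s)" for s
  have scheme: "pointed_scheme Q x U"
    unfolding pointed_scheme_def x_def
  proof (intro allI conjI)
    fix s
    show "openin Q (U s)" "p (U s) \<in> U s"
      using U_G[rule_format, of s] p(1)[of "U s"] by (auto simp: G_def)
    show "pointed_refinement Q (p (U s)) (U s) (\<lambda>n. U (n # s))"
      using U_step by blast
  qed
  \<comment> \<open>Going up a branch, the first elements move strictly forward in the enumeration.\<close>
  have index: "length s \<le> to_nat_on \<rat> (x s)" for s
  proof (induction s)
    case (Cons n s)
    have in_parent: "x (n # s) \<in> U s" "x (n # s) \<noteq> x s"
      using scheme_child_subset[OF scheme, of n s] scheme_point[OF scheme, of "n # s"] by blast+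
    have "x (n # s) \<in> \<rat>" "x s \<in> \<rat>"
      using scheme_range_subset[OF scheme] by (auto simp: Q_def)
    then have "to_nat_on \<rat> (x (n # s)) \<noteq> to_nat_on \<rat> (x s)"
      using in_parent(2) by (simp add: to_nat_on_inj[OF countable_rat])
    moreover have "to_nat_on \<rat> (x s) \<le> to_nat_on \<rat> (x (n # s))"
      using p(2)[of "U s"] in_parent(1) by (auto simp: x_def)
    ultimately show ?case using Cons by simp
  qed simp
  have "\<rat> \<subseteq> range x"
  proof (rule ccontr)
    assume "\<not> \<rat> \<subseteq> range x"
    then obtain q where q: "q \<in> \<rat>" "q \<notin> range x" by blast
    have "\<exists>s. length s = k \<and> q \<in> U s" for k
    proof (induction k)
      case 0
      then show ?case using q U_Nil by auto
    next
      case (Suc k)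
      then obtain s where s: "length s = k" "q \<in> U s" by blast
      then have "q \<in> (\<Union>n. U (n # s))" using q U_step[rule_format, of s] by (auto simp: x_def)
      then obtain n where "q \<in> U (n # s)" by blast
      then show ?case using s by (intro exI[of _ "n # s"]) simp
    qed
    \<comment> \<open>At this level the first element of \<open>U s\<close> comes after \<open>q\<close>, although \<open>q\<close> lies in \<open>U s\<close>.\<close>
    then obtain s where s: "length s = Suc (to_nat_on \<rat> q)" "q \<in> U s" by blast
    then have "to_nat_on \<rat> (x s) \<le> to_nat_on \<rat> q" using p(2)[of "U s"] by (auto simp: x_def)
    then show False using index[of s] s by simp
  qed
  then have "range x = \<rat>"
    using scheme_range_subset[OF scheme] by (auto simp: Q_def)
  then show ?thesis
    using scheme_range_homeomorphic_tree[OF scheme] by (simp add: Q_def subtopology_subtopology)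
qed

section \<open>Refinements in spaces of the first category\<close>

text \<open>Each new index is chosen beyond the exceptions of all indices up to the previous one. This thins
  out a convergent sequence of sets to a disjoint one.\<close>

lemma cofinite_pairs_strict_mono_subsequence:
  fixes R :: "nat \<Rightarrow> nat \<Rightarrow> bool"
  assumes "\<And>i. finite {j. \<not> R i j}"
  obtains e :: "nat \<Rightarrow> nat" where "strict_mono e" "\<And>i j. i < j \<Longrightarrow> R (e i) (e j)"
proof -
  have "\<exists>b>i. \<forall>k\<le>i. \<forall>j\<ge>b. R k j" for i
  proof -
    have "finite ((\<Union>k\<le>i. {j. \<not> R k j}) \<union> {i})" using assms by simp
    then obtain b where "(\<Union>k\<le>i. {j. \<not> R k j}) \<union> {i} \<subseteq> {..<b}"
      using finite_nat_bounded by blast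
    then have "b > i \<and> (\<forall>k\<le>i. \<forall>j\<ge>b. R k j)"
      by (fastforce simp: not_le[symmetric])
    then show ?thesis by blast
  qed
  then obtain b where b: "\<And>i. b i > i" "\<And>i k j. \<lbrakk>k \<le> i; j \<ge> b i\<rbrakk> \<Longrightarrow> R k j"
    by metis
  \<comment> \<open>\<open>b i\<close> bounds the exceptions of every \<open>k \<le> i\<close>, so iterating \<open>b\<close> takes care of all earlier
     terms and not just of the last one.\<close>
  define e where "e n = (b ^^ n) 0" for n
  have e_Suc: "e (Suc n) = b (e n)" for n by (simp add: e_def)
  have mono: "strict_mono e"
    using b(1) by (simp add: strict_mono_Suc_iff e_Suc)
  moreover have "R (e i) (e j)" if "i < j" for i j
    using strict_mono_leD[OF mono, of "Suc i" j] that b(2)[of "e i" "e i" "e j"] by (simp add: e_Suc)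
  ultimately show thesis using that by blast
qed

lemma first_category_space_no_isolated_point:
  assumes "first_category_space X"
  shows "\<not> openin X {y}"
proof
  assume open_y: "openin X {y}"
  then have "y \<in> topspace X" using openin_subset by blast
  then obtain A where A: "nowhere_dense_in X A" "y \<in> A"
    using assms unfolding first_category_space_def by blast
  then have "y \<in> X closure_of A"
    unfolding nowhere_dense_in_def using closure_of_subset by blast
  then have "y \<in> X interior_of (X closure_of A)"
    using interior_of_maximal[OF _ open_y] by blast
  then show False using A unfolding nowhere_dense_in_def by blast
qed

text \<open>A nonempty open set stays nonempty after removal of \<open>F\<close>, which has no interior, and after removal
  of a further point, which is not isolated; regularity then shrinks the remainder.\<close>

lemma regular_shrink_off_point_and_closed:
  assumes "regular_space X" "t1_space X" "\<not> (\<exists>z. openin X {z})"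
    and F: "closedin X F" "X interior_of F = {}"
    and W: "openin X W" "W \<noteq> {}"
  obtains V where "openin X V" "V \<noteq> {}" "X closure_of V \<subseteq> W - F - {y}"
proof -
  have "openin X (W - F)" using F W by (simp add: openin_diff)
  moreover have "W - F \<noteq> {}"
    using interior_of_maximal[of W F X] F(2) W by blast
  ultimately have ne: "W - F - {y} \<noteq> {}"
    using assms(3) by (metis Diff_eq_empty_iff subset_singletonD)
  have "openin X (W - F - {y})"
  proof (cases "y \<in> topspace X")
    case True
    then show ?thesis using \<open>openin X (W - F)\<close> assms(2)
      by (simp add: openin_diff t1_space_closedin_singleton)
  next
    case False
    then have "W - F - {y} = W - F" using W openin_subset by fastforce
    then show ?thesis using \<open>openin X (W - F)\<close> by simp
  qed
  then obtain V C where "openin X V" "closedin X C" "V \<noteq> {}" "V \<subseteq> C" "C \<subseteq> W - F - {y}"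
    using assms(1) ne unfolding neighbourhood_base_of_closedin[symmetric] neighbourhood_base_of
    by (metis all_not_in_conv)
  then show thesis
    using that closure_of_minimal[of V C X] by blast
qed

text \<open>Shrinking the given open sets preserves their convergence to \<open>y\<close>. Once the closure of each set
  misses \<open>y\<close>, its complement is a neighbourhood of \<open>y\<close> and contains almost all of the other sets;
  hence a subsequence is disjoint.\<close>

lemma weakly_Preiss_Simon_pointed_refinement:
  assumes X: "regular_space X" "t1_space X" "\<not> (\<exists>z. openin X {z})"
    and F: "closedin X F" "X interior_of F = {}"
    and y: "weakly_Preiss_Simon_at X y" and U: "openin X U" "y \<in> U"
  shows "\<exists>V. (\<forall>n. openin X (V n) \<and> V n \<noteq> {} \<and> F \<inter> X closure_of V n = {}) \<and>
             pointed_refinement X y U V"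
proof -
  obtain W where W: "\<And>n. openin X (W n)" "\<And>n. W n \<noteq> {}" "sets_converge_to X W y"
    using y unfolding weakly_Preiss_Simon_at_def by blast
  have "finite {n. \<not> W n \<subseteq> U}"
    using W(3) U by (simp add: sets_converge_to_def)
  then obtain N where N: "{n. \<not> W n \<subseteq> U} \<subseteq> {..<N}"
    using finite_nat_bounded by blast
  have "\<exists>V. openin X V \<and> V \<noteq> {} \<and> X closure_of V \<subseteq> W (n + N) - F - {y}" for n
    using regular_shrink_off_point_and_closed[OF X F W(1,2)] by metis
  then obtain O' where O': "\<And>n. openin X (O' n)" "\<And>n. O' n \<noteq> {}"
      "\<And>n. X closure_of O' n \<subseteq> W (n + N) - F - {y}"
    by metis
  have O'_closure: "O' n \<subseteq> X closure_of O' n" for n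
    using O'(1) by (simp add: closure_of_subset openin_subset)
  have O'_conv: "finite {n. \<not> O' n \<subseteq> T}" if "openin X T" "y \<in> T" for T
  proof -
    have "finite ((\<lambda>n. n + N) -` {n. \<not> W n \<subseteq> T})"
      using W(3) that by (intro finite_vimageI) (auto simp: sets_converge_to_def inj_def)
    then show ?thesis
      by (rule rev_finite_subset) (use O'(3) O'_closure in fastforce)
  qed
  have "finite {j. \<not> O' i \<inter> O' j = {}}" for i
  proof -
    have "y \<in> topspace X" using U openin_subset by blast
    then have "finite {j. \<not> O' j \<subseteq> topspace X - X closure_of O' i}"
      using O'(3) by (intro O'_conv) auto
    then show ?thesis
      by (rule rev_finite_subset) (use O'_closure in blast)
  qed
  then obtain e :: "nat \<Rightarrow> nat" where e: "strict_mono e" "\<And>i j. i < j \<Longrightarrow> O' (e i) \<inter> O' (e j) = {}"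
    using cofinite_pairs_strict_mono_subsequence[of "\<lambda>i j. O' i \<inter> O' j = {}"] by blast
  define V where "V n = O' (e n)" for n
  have "disjoint_family V"
    using e(2) unfolding V_def disjoint_family_on_def by (metis Int_commute nat_neq_iff)
  moreover have "sets_converge_to X V y"
    unfolding sets_converge_to_def
  proof (intro allI impI)
    fix T assume "openin X T \<and> y \<in> T"
    then have "finite (e -` {n. \<not> O' n \<subseteq> T})"
      using O'_conv strict_mono_imp_inj_on[OF e(1)] by (intro finite_vimageI) auto
    then show "finite {n. \<not> V n \<subseteq> T}" by (simp add: V_def vimage_def)
  qed
  moreover have V_closure: "X closure_of V n \<subseteq> U - F - {y}" for n
  proof -
    have "W (e n + N) \<subseteq> U" using N[THEN subsetD, of "e n + N"] by auto
    then show ?thesis using O'(3)[of "e n"] by (auto simp: V_def)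
  qed
  ultimately have "pointed_refinement X y U V"
    unfolding pointed_refinement_def by blast
  moreover have "openin X (V n) \<and> V n \<noteq> {} \<and> F \<inter> X closure_of V n = {}" for n
    using O'(1,2) V_closure[of n] by (auto simp: V_def)
  ultimately show ?thesis by blast
qed

section \<open>A closed range\<close>

text \<open>Let \<open>y\<close> be in the closure of the points above \<open>s\<close> but different from \<open>x s\<close>. Separate \<open>y\<close> from
  \<open>x s\<close>: almost all children lie in the neighbourhood of \<open>x s\<close>, so \<open>y\<close> is in the closure of the
  points above one of the finitely many others. Hence a limit point outside the range lies in the
  closure of some \<open>U s\<close> at every level, while the sets at level \<open>k + 1\<close> avoid \<open>F k\<close>.\<close>

lemma closedin_scheme_range:
  assumes "Hausdorff_space X" and scheme: "pointed_scheme X x U"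
    and F: "topspace X \<subseteq> (\<Union>k. F k)"
    and avoid: "\<And>n s. F (length s) \<inter> X closure_of U (n # s) = {}"
  shows "closedin X (range x)"
proof (rule ccontr)
  assume "\<not> closedin X (range x)"
  then obtain y where y: "y \<in> X closure_of range x" "y \<notin> range x"
    using scheme_range_subset[OF scheme] closure_of_subset_eq by fast
  have y_top: "y \<in> topspace X" using y(1) by (meson in_closure_of)
  define T where "T s = x ` {u @ s |u. True}" for s
  have T_sub: "T s \<subseteq> U s" for s
    using scheme_append_subset[OF scheme] scheme_point[OF scheme] unfolding T_def by blast
  have branch: "\<exists>s. length s = k \<and> y \<in> X closure_of T s" for k
  proof (induction k)
    case 0
    have "T [] = range x" by (auto simp: T_def)
    then show ?case using y(1) by (intro exI[of _ "[]"]) simp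
  next
    case (Suc k)
    then obtain s where s: "length s = k" "y \<in> X closure_of T s" by blast
    have "x s \<in> topspace X" "y \<noteq> x s"
      using y(2) scheme_range_subset[OF scheme] by auto
    then obtain A B where AB: "openin X A" "openin X B" "y \<in> A" "x s \<in> B" "disjnt A B"
      using \<open>Hausdorff_space X\<close> y_top unfolding Hausdorff_space_def by metis
    define J where "J = {n. \<not> U (n # s) \<subseteq> B}"
    have "finite J"
      using scheme_converges[OF scheme] AB unfolding J_def sets_converge_to_def by blast
    have "T s \<subseteq> B \<union> (\<Union>n\<in>J. T (n # s))"
    proof
      fix z assume "z \<in> T s"
      then obtain u where u: "z = x (u @ s)" by (auto simp: T_def)
      show "z \<in> B \<union> (\<Union>n\<in>J. T (n # s))"
      proof (cases u rule: rev_cases)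
        case Nil
        then show ?thesis using u AB by simp
      next
        case (snoc v n)
        then have "z \<in> T (n # s)" using u by (auto simp: T_def)
        then show ?thesis using T_sub unfolding J_def by blast
      qed
    qed
    then have "X closure_of T s \<subseteq> X closure_of B \<union> (\<Union>n\<in>J. X closure_of T (n # s))"
      using \<open>finite J\<close> closure_of_mono[of "T s" "B \<union> (\<Union>n\<in>J. T (n # s))" X]
      by (simp add: closure_of_Union image_image)
    moreover have "y \<notin> X closure_of B"
      using AB by (auto simp: in_closure_of disjnt_iff)
    ultimately obtain n where "y \<in> X closure_of T (n # s)" using s(2) by blast
    then show ?case using s by (intro exI[of _ "n # s"]) simp
  qed
  obtain k where k: "y \<in> F k" using F y_top by blast
  obtain t where t: "length t = Suc k" "y \<in> X closure_of T t" using branch by blast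
  then obtain n s where "t = n # s" "length s = k" by (cases t) auto
  then show False
    using avoid[of s n] k t closure_of_mono[OF T_sub[of t], of X] by blast
qed

section \<open>Closed copies of the rationals\<close>

theorem theorem1:
  fixes X :: "'a topology"
  assumes "topspace X \<noteq> {}"
    and "regular_space X" and "t1_space X"
    and "first_category_space X"
    and "X closure_of (wPS X) = topspace X"
  shows "\<exists>C. closedin X C \<and> subtopology X C homeomorphic_space top_of_set (\<rat> :: real set)"
proof -
  obtain \<A> where \<A>: "countable \<A>" "\<forall>A\<in>\<A>. nowhere_dense_in X A" "\<Union>\<A> = topspace X"
    using assms(4) unfolding first_category_space_def by (elim exE conjE) (rule that)
  have "\<A> \<noteq> {}" using \<A>(3) assms(1) by (metis Sup_empty)
  define F where "F k = X closure_of (from_nat_into \<A> k)" for k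
  have nd: "nowhere_dense_in X (from_nat_into \<A> k)" for k
    using \<A>(2) from_nat_into[OF \<open>\<A> \<noteq> {}\<close>] by blast
  have F: "closedin X (F k)" "X interior_of (F k) = {}" for k
    using nd unfolding F_def nowhere_dense_in_def by auto
  have F_cover: "topspace X \<subseteq> (\<Union>k. F k)"
  proof
    fix y assume "y \<in> topspace X"
    then obtain A where "A \<in> \<A>" "y \<in> A" using \<A>(3) by blast
    then obtain k where "y \<in> from_nat_into \<A> k"
      using from_nat_into_surj[OF \<A>(1)] by metis
    moreover have "from_nat_into \<A> k \<subseteq> F k"
      using nd[of k] unfolding F_def nowhere_dense_in_def by (simp add: closure_of_subset)
    ultimately show "y \<in> (\<Union>k. F k)" by blast
  qed
  have dense: "\<exists>y\<in>V. y \<in> wPS X" if "openin X V" "V \<noteq> {}" for V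
    using that assms(5) openin_subset[OF that(1)] openin_Int_closure_of_eq_empty[OF that(1), of "wPS X"]
    by (metis disjoint_iff inf.absorb1)
  \<comment> \<open>A node carries a point of \<open>wPS X\<close> with an open neighbourhood; at level \<open>k\<close> its children are
     chosen away from \<open>F k\<close>.\<close>
  define G where "G = (\<lambda>(y, V). openin X V \<and> y \<in> V \<and> y \<in> wPS X)"
  define R where "R = (\<lambda>k (y, V) b. pointed_refinement X y V (\<lambda>n :: nat. snd (b n :: 'a \<times> 'a set)) \<and>
    (\<forall>n. F k \<inter> X closure_of snd (b n) = {}))"
  obtain y0 where y0: "y0 \<in> wPS X" using dense[of "topspace X"] assms(1) by auto
  have "\<exists>f. f [] = (y0, topspace X) \<and> (\<forall>s. G (f s)) \<and> (\<forall>s. R (length s) (f s) (\<lambda>n. f (n # s)))"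
  proof (rule dependent_choice_on_nat_tree)
    show "G (y0, topspace X)" using y0 by (auto simp: G_def wPS_def)
  next
    fix k and a :: "'a \<times> 'a set" assume "G a"
    then obtain y V where a: "a = (y, V)" and V: "openin X V" "y \<in> V" "weakly_Preiss_Simon_at X y"
      by (auto simp: G_def wPS_def)
    obtain V' where V': "\<And>n. openin X (V' n)" "\<And>n. V' n \<noteq> {}" "\<And>n. F k \<inter> X closure_of V' n = {}"
        "pointed_refinement X y V V'"
      using weakly_Preiss_Simon_pointed_refinement[OF assms(2,3) _ F[of k] V(3) V(1,2)]
        first_category_space_no_isolated_point[OF assms(4)] by metis
    have "\<forall>n. \<exists>y. y \<in> V' n \<and> y \<in> wPS X"
      using dense[OF V'(1,2)] by blast
    then obtain z where z: "\<And>n. z n \<in> V' n" "\<And>n. z n \<in> wPS X"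
      by metis
    show "\<exists>b. (\<forall>n. G (b n)) \<and> R k a b"
      using V' z by (intro exI[of _ "\<lambda>n. (z n, V' n)"]) (simp add: G_def R_def a)
  qed
  then obtain f where f: "\<forall>s. G (f s)" "\<forall>s. R (length s) (f s) (\<lambda>n. f (n # s))"
    by (elim exE conjE) (rule that)
  define x where "x s = fst (f s)" for s
  define U where "U s = snd (f s)" for s
  have scheme: "pointed_scheme X x U"
    using f unfolding pointed_scheme_def by (simp add: G_def R_def x_def U_def case_prod_unfold)
  have avoid: "F (length s) \<inter> X closure_of U (n # s) = {}" for n s
    using f(2)[rule_format, of s] by (simp add: R_def U_def case_prod_unfold)
  have "closedin X (range x)"
    using closedin_scheme_range[OF _ scheme F_cover avoid] assms(2,3)
    by (simp add: regular_t1_imp_Hausdorff_space)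
  moreover have "subtopology X (range x) homeomorphic_space top_of_set (\<rat> :: real set)"
    using scheme_range_homeomorphic_tree[OF scheme] Rats_homeomorphic_tree
    by (meson homeomorphic_space_sym homeomorphic_space_trans)
  ultimately show ?thesis by blast
qed

end
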